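(* For $2\le B\le 10$, the Gaussian $B$-happy numbers of height $3$ of smallest absolute value are exactly the numbers $z,-z,\pm\overline{z},\pm iz,\pm i\overline{z}$, where $z=1+i$ for $B=2$; $z=7+10i$ for $B=3$; $z=1+i$ for $B=4$; $z=4+15i$ for $B=5$; $z=11+17i$ for $B=6$; $z=20+27i$ for $B=7$; $z=2+2i$ for $B=8$; $z=2+9i$ for $B=9$; $z=12+12i$ for $B=10$ (all written in ordinary decimal notation).
   Context: Fix an integer $B\ge 2$. Every nonzero Gaussian integer $a+bi$ is written uniquely as $a+bi=\sum_{j=0}^n (a_j+b_ji)B^j$ with $a_j,b_j\in\mathbb{Z}$, $a_n,b_n$ not both $0$, and for each $j$: $|a_j|\le B-1$, $|b_j|\le B-1$, $\operatorname{sgn}(a)a_j\ge 0$, $\operatorname{sgn}(b)b_j\ge 0$. The Gaussian $B$-happy function $S_B:\mathbb{Z}[i]\to\mathbb{Z}[i]$ is defined by $S_B(0)=0$ and $S_B(a+bi)=\sum_{j=0}^n (a_j+b_ji)^2$. A Gaussian integer $z$ is Gaussian $B$-happy if $S_B^k(z)=1$ for some $k\ge1$. The height of a Gaussian $B$-happy number $z$ is the least $k\in\mathbb{Z}_{\ge0}$ with $S_B^k(z)=1$ ($S_B^0$ is the identity). "Smallest" means of minimal complex absolute value. *)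

theory Defs
  imports Complex_Main
begin

definition gaussian_ints :: "complex set" where
  "gaussian_ints = {z. Re z \<in> \<int> \<and> Im z \<in> \<int>}"

definition gaussian_expansion ::
  "nat \<Rightarrow> complex \<Rightarrow> nat \<Rightarrow> (nat \<Rightarrow> int) \<Rightarrow> (nat \<Rightarrow> int) \<Rightarrow> bool" where
  "gaussian_expansion B z n a b \<longleftrightarrow>
     z = (\<Sum>j\<le>n. (of_int (a j) + of_int (b j) * \<i>) * of_nat B ^ j) \<and>
     (a n \<noteq> 0 \<or> b n \<noteq> 0) \<and>
     (\<forall>j\<le>n. \<bar>a j\<bar> \<le> int B - 1 \<and> \<bar>b j\<bar> \<le> int B - 1 \<and>
            sgn (Re z) * of_int (a j) \<ge> 0 \<and> sgn (Im z) * of_int (b j) \<ge> 0)"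

text \<open>
  The description below is proper for every nonzero Gaussian integer when \<open>B \<ge> 2\<close>
  (lemma \<open>gaussian_digit_square_sum_unique\<close>); outside the Gaussian integers the value is
  irrelevant.
\<close>

definition gaussian_happy_fun :: "nat \<Rightarrow> complex \<Rightarrow> complex" where
  "gaussian_happy_fun B z =
     (if z = 0 then 0
      else THE w. \<exists>n a b. gaussian_expansion B z n a b \<and>
             w = (\<Sum>j\<le>n. (of_int (a j) + of_int (b j) * \<i>)\<^sup>2))"

definition gaussian_happy :: "nat \<Rightarrow> complex \<Rightarrow> bool" where
  "gaussian_happy B z \<longleftrightarrow> z \<in> gaussian_ints \<and> (\<exists>k\<ge>1. (gaussian_happy_fun B ^^ k) z = 1)"

definition gaussian_happy_height :: "nat \<Rightarrow> complex \<Rightarrow> nat" where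
  "gaussian_happy_height B z = (LEAST k. (gaussian_happy_fun B ^^ k) z = 1)"

lemma digits_of_zero:
  fixes d :: "nat \<Rightarrow> int" and B :: int
  assumes "(\<Sum>j\<le>N. d j * B ^ j) = 0" "\<And>j. j \<le> N \<Longrightarrow> \<bar>d j\<bar> \<le> B - 1" "B \<ge> 2" "j \<le> N"
  shows "d j = 0"
  using assms
proof (induction N arbitrary: d j)
  case 0
  then show ?case by simp
next
  case (Suc N)
  let ?s = "\<Sum>j\<le>N. d (Suc j) * B ^ j"
  have "(\<Sum>j\<le>Suc N. d j * B ^ j) = d 0 + (\<Sum>j\<le>N. d (Suc j) * B ^ Suc j)"
    by (subst sum.atMost_Suc_shift) simp
  also have "(\<Sum>j\<le>N. d (Suc j) * B ^ Suc j) = B * ?s"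
    unfolding sum_distrib_left by (intro sum.cong) (auto simp: mult_ac)
  finally have eq: "d 0 + B * ?s = 0" using Suc.prems(1) by simp
  then have "d 0 = B * (- ?s)" by simp
  then have "B dvd d 0" by (rule dvdI)
  moreover have "\<bar>d 0\<bar> < B" using Suc.prems(2)[of 0] by simp
  ultimately have d0: "d 0 = 0"
    using dvd_imp_le_int[of "d 0" B] by linarith
  with eq Suc.prems(3) have s0: "?s = 0" by simp
  show ?case
  proof (cases j)
    case (Suc i)
    with Suc.IH[of "\<lambda>j. d (Suc j)" i] s0 Suc.prems show ?thesis by simp
  qed (use d0 in simp)
qed

lemma signed_digits_unique:
  fixes a b :: "nat \<Rightarrow> int" and B :: int
  assumes a: "x = (\<Sum>j\<le>N. a j * B ^ j)" "\<And>j. j \<le> N \<Longrightarrow> \<bar>a j\<bar> \<le> B - 1 \<and> sgn x * a j \<ge> 0"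
    and b: "x = (\<Sum>j\<le>N. b j * B ^ j)" "\<And>j. j \<le> N \<Longrightarrow> \<bar>b j\<bar> \<le> B - 1 \<and> sgn x * b j \<ge> 0"
    and B: "B \<ge> 2" and j: "j \<le> N"
  shows "a j = b j"
proof (cases "x = 0")
  case True
  then show ?thesis
    using digits_of_zero[of a B N j] digits_of_zero[of b B N j] assms by auto
next
  case False
  have "(\<Sum>j\<le>N. (a j - b j) * B ^ j) = 0"
    using a(1) b(1) by (simp add: left_diff_distrib sum_subtractf)
  moreover have "\<bar>a i - b i\<bar> \<le> B - 1" if "i \<le> N" for i
    using a(2)[OF that] b(2)[OF that] False by (cases "x > 0") (auto simp: sgn_if split: if_splits)
  ultimately have "a j - b j = 0"
    using digits_of_zero[of "\<lambda>j. a j - b j" B N j] B j by blast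
  then show ?thesis by simp
qed

lemma signed_digits_exist:
  fixes x B :: int
  assumes B: "B \<ge> 2" and x: "\<bar>x\<bar> < B ^ Suc N"
  shows "\<exists>a. x = (\<Sum>j\<le>N. a j * B ^ j) \<and> (\<forall>j. \<bar>a j\<bar> \<le> B - 1 \<and> sgn x * a j \<ge> 0)"
proof -
  define c where "c j = \<bar>x\<bar> div B ^ j mod B" for j
  have c: "0 \<le> c j" "c j \<le> B - 1" for j
    using B by (simp_all add: c_def)
  have *: "(\<Sum>j\<le>M. c j * B ^ j) = \<bar>x\<bar> mod B ^ Suc M" for M
  proof (induction M)
    case (Suc M)
    have "\<bar>x\<bar> mod (B ^ Suc M * B) = B ^ Suc M * (\<bar>x\<bar> div B ^ Suc M mod B) + \<bar>x\<bar> mod B ^ Suc M"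
      using B by (intro zmod_zmult2_eq) simp
    then show ?case using Suc by (simp add: c_def mult_ac)
  qed (simp add: c_def)
  have "\<bar>x\<bar> = (\<Sum>j\<le>N. c j * B ^ j)"
    using * x by simp
  then have "sgn x * \<bar>x\<bar> = sgn x * (\<Sum>j\<le>N. c j * B ^ j)" by (rule arg_cong)
  then have "x = (\<Sum>j\<le>N. sgn x * c j * B ^ j)"
    by (simp add: sum_distrib_left mult.assoc sgn_mult_abs)
  moreover have "\<bar>sgn x * c j\<bar> \<le> B - 1 \<and> sgn x * (sgn x * c j) \<ge> 0" for j
    using c[of j] B by (auto simp: sgn_if)
  ultimately show ?thesis by (intro exI[of _ "\<lambda>j. sgn x * c j"]) blast
qed

lemma gaussian_expansion_parts:
  assumes "gaussian_expansion B z n a b"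
  shows "Re z = of_int (\<Sum>j\<le>n. a j * int B ^ j)" "Im z = of_int (\<Sum>j\<le>n. b j * int B ^ j)"
proof -
  have z: "z = (\<Sum>j\<le>n. (of_int (a j) + of_int (b j) * \<i>) * of_nat B ^ j)"
    using assms by (simp add: gaussian_expansion_def)
  have "(of_int (a j) + of_int (b j) * \<i>) * of_nat B ^ j
          = complex_of_real (of_int (a j * int B ^ j)) + complex_of_real (of_int (b j * int B ^ j)) * \<i>" for j
    by (simp add: algebra_simps)
  then have z': "z = (\<Sum>j\<le>n. complex_of_real (of_int (a j * int B ^ j)) + complex_of_real (of_int (b j * int B ^ j)) * \<i>)"
    using z by simp
  show "Re z = of_int (\<Sum>j\<le>n. a j * int B ^ j)" by (subst z') simp
  show "Im z = of_int (\<Sum>j\<le>n. b j * int B ^ j)" by (subst z') simp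
qed

lemma sgn_of_int_mult_nonneg:
  "sgn (of_int x :: real) * of_int a \<ge> 0 \<longleftrightarrow> sgn x * a \<ge> (0 :: int)"
  by (cases x "0 :: int" rule: linorder_cases) simp_all

lemma gaussian_expansion_padded:
  assumes e: "gaussian_expansion B z n a b" and N: "n \<le> N" and x: "Re z = of_int x" and y: "Im z = of_int y"
  defines "a' \<equiv> \<lambda>j. if j \<le> n then a j else 0" and "b' \<equiv> \<lambda>j. if j \<le> n then b j else 0"
  assumes B: "B \<ge> 2"
  shows "x = (\<Sum>j\<le>N. a' j * int B ^ j)" "y = (\<Sum>j\<le>N. b' j * int B ^ j)"
    "\<bar>a' j\<bar> \<le> int B - 1 \<and> sgn x * a' j \<ge> 0" "\<bar>b' j\<bar> \<le> int B - 1 \<and> sgn y * b' j \<ge> 0"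
    "(\<Sum>j\<le>n. (of_int (a j) + of_int (b j) * \<i>)\<^sup>2) = (\<Sum>j\<le>N. (of_int (a' j) + of_int (b' j) * \<i>)\<^sup>2)"
proof -
  have pad: "(\<Sum>j\<le>n. f j) = (\<Sum>j\<le>N. if j \<le> n then f j else 0)" for f :: "nat \<Rightarrow> 'b :: comm_monoid_add"
    using N by (intro sum.mono_neutral_cong_left) auto
  have xe: "x = (\<Sum>j\<le>n. a j * int B ^ j)" and ye: "y = (\<Sum>j\<le>n. b j * int B ^ j)"
    using gaussian_expansion_parts[OF e] unfolding x y of_int_eq_iff by blast+
  show "x = (\<Sum>j\<le>N. a' j * int B ^ j)"
    unfolding xe by (subst pad, intro sum.cong) (auto simp: a'_def)
  show "y = (\<Sum>j\<le>N. b' j * int B ^ j)"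
    unfolding ye by (subst pad, intro sum.cong) (auto simp: b'_def)
  show "\<bar>a' j\<bar> \<le> int B - 1 \<and> sgn x * a' j \<ge> 0" "\<bar>b' j\<bar> \<le> int B - 1 \<and> sgn y * b' j \<ge> 0"
    using e B unfolding gaussian_expansion_def x y sgn_of_int_mult_nonneg
    by (auto simp: a'_def b'_def)
  show "(\<Sum>j\<le>n. (of_int (a j) + of_int (b j) * \<i>)\<^sup>2) = (\<Sum>j\<le>N. (of_int (a' j) + of_int (b' j) * \<i>)\<^sup>2)"
    by (subst pad, intro sum.cong) (auto simp: a'_def b'_def)
qed

lemma gaussian_expansion_exists:
  assumes B: "B \<ge> 2" and z: "z \<in> gaussian_ints" "z \<noteq> 0"
  shows "\<exists>n a b. gaussian_expansion B z n a b"
proof -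
  from z(1) obtain x y :: int where xy: "Re z = of_int x" "Im z = of_int y"
    by (auto simp: gaussian_ints_def elim!: Ints_cases)
  define N where "N = nat (\<bar>x\<bar> + \<bar>y\<bar>)"
  have "N < 2 ^ N" by (rule less_exp)
  also have "2 ^ N \<le> B ^ N" using B by (intro power_mono) auto
  also have "B ^ N \<le> B ^ Suc N" using B by simp
  finally have "int N < int B ^ Suc N" by (metis of_nat_less_iff of_nat_power)
  then have "\<bar>x\<bar> < int B ^ Suc N" "\<bar>y\<bar> < int B ^ Suc N" by (simp_all add: N_def)
  moreover have "int B \<ge> 2" using B by simp
  ultimately obtain a b where a: "x = (\<Sum>j\<le>N. a j * int B ^ j)" "\<And>j. \<bar>a j\<bar> \<le> int B - 1 \<and> sgn x * a j \<ge> 0"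
    and b: "y = (\<Sum>j\<le>N. b j * int B ^ j)" "\<And>j. \<bar>b j\<bar> \<le> int B - 1 \<and> sgn y * b j \<ge> 0"
    using signed_digits_exist[of "int B" x N] signed_digits_exist[of "int B" y N] by blast
  define n where "n = Max {j. j \<le> N \<and> (a j \<noteq> 0 \<or> b j \<noteq> 0)}"
  have "{j. j \<le> N \<and> (a j \<noteq> 0 \<or> b j \<noteq> 0)} \<noteq> {}"
  proof
    assume "{j. j \<le> N \<and> (a j \<noteq> 0 \<or> b j \<noteq> 0)} = {}"
    then have "x = 0" "y = 0" using a(1) b(1) by (auto intro!: sum.neutral)
    with xy z(2) show False by (simp add: complex_eq_iff)
  qed
  then have n: "n \<in> {j. j \<le> N \<and> (a j \<noteq> 0 \<or> b j \<noteq> 0)}"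
    unfolding n_def by (intro Max_in) auto
  have big: "a j = 0 \<and> b j = 0" if "j \<le> N" "j > n" for j
  proof (rule ccontr)
    assume "\<not> ?thesis"
    then have "j \<le> n" unfolding n_def using that by (intro Max_ge) auto
    with that show False by simp
  qed
  have "z = of_int x + of_int y * \<i>"
    using xy by (simp add: complex_eq_iff)
  also have "\<dots> = (\<Sum>j\<le>N. (of_int (a j) + of_int (b j) * \<i>) * of_nat B ^ j)"
    by (subst a(1), subst b(1)) (simp add: sum.distrib sum_distrib_left sum_distrib_right algebra_simps)
  also have "\<dots> = (\<Sum>j\<le>n. (of_int (a j) + of_int (b j) * \<i>) * of_nat B ^ j)"
    using n big by (intro sum.mono_neutral_right) auto
  finally have "gaussian_expansion B z n a b"
    using n a(2) b(2) unfolding gaussian_expansion_def xy sgn_of_int_mult_nonneg by blast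
  then show ?thesis by blast
qed

lemma gaussian_digit_square_sum_unique:
  assumes B: "B \<ge> 2" and z: "z \<in> gaussian_ints" "z \<noteq> 0"
  shows "\<exists>!w. \<exists>n a b. gaussian_expansion B z n a b \<and>
           w = (\<Sum>j\<le>n. (of_int (a j) + of_int (b j) * \<i>)\<^sup>2)"
proof -
  from z(1) obtain x y :: int where xy: "Re z = of_int x" "Im z = of_int y"
    by (auto simp: gaussian_ints_def elim!: Ints_cases)
  have uniq: "(\<Sum>j\<le>n. (of_int (a j) + of_int (b j) * \<i>)\<^sup>2) = (\<Sum>j\<le>m. (of_int (c j) + of_int (d j) * \<i>)\<^sup>2)"
    if e: "gaussian_expansion B z n a b" and f: "gaussian_expansion B z m c d" for n m a b c d
  proof -
    note p = gaussian_expansion_padded[OF e max.cobounded1[of n m] xy B]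
    note q = gaussian_expansion_padded[OF f max.cobounded2[of m n] xy B]
    have B': "int B \<ge> 2" using B by simp
    note u = signed_digits_unique[OF p(1,3) q(1,3) B'] signed_digits_unique[OF p(2,4) q(2,4) B']
    show ?thesis unfolding p(5) q(5) 
    proof (rule sum.cong[OF refl], goal_cases)
      case (1 j)
      then have "j \<le> max n m" by simp
      from u[OF this] show ?case by (simp only:)
    qed
  qed
  from gaussian_expansion_exists[OF assms] obtain n a b where "gaussian_expansion B z n a b" by blast
  then show ?thesis using uniq by blast
qed

end

(* S_B acts on pairs of integers by an executable recursion on base-B digits. Negating or swapping
   the coordinates only changes the signs of the coordinates of S_B, so whether S_B^3 z = 1 and
   S_B^2 z \<noteq> 1 is unaffected, and it suffices to inspect the finitely many points with
   0 \<le> y \<le> x in the disc of radius |z|. *)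

theory Submission
  imports Defs
begin

section \<open>Digit square sums of pairs of non-negative integers\<close>

text \<open>Each call splits off the lowest digits \<open>p\<close> and \<open>q\<close> and adds
  the real and imaginary parts of the square of p + qi. Negative arguments and \<open>B < 2\<close>
  get a default value so that the recursion terminates.\<close>

function digit_square_sum :: "int \<Rightarrow> int \<Rightarrow> int \<Rightarrow> int \<times> int" where
  "digit_square_sum B x y =
     (if B < 2 \<or> x < 0 \<or> y < 0 \<or> x = 0 \<and> y = 0 then (0, 0)
      else let p = x mod B; q = y mod B; r = digit_square_sum B (x div B) (y div B)
           in (p * p - q * q + fst r, 2 * (p * q) + snd r))"
  by auto

termination
proof (relation "Wellfounded.measure (\<lambda>(B, x, y). nat (x + y))")
  fix B x y :: int
  assume "\<not> (B < 2 \<or> x < 0 \<or> y < 0 \<or> x = 0 \<and> y = 0)"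
  then have B: "2 \<le> B" "0 \<le> x" "0 \<le> y" and pos: "0 < x \<or> 0 < y" by auto
  \<comment> \<open>A zero coordinate stays zero, so the strict decrease must come from a positive
    one.\<close>
  have "t div B \<le> t \<and> (0 < t \<longrightarrow> t div B < t)" if "0 \<le> t" for t
    using that B(1) int_div_less_self[of t B] by (cases "t = 0") auto
  from this[of x] this[of y] B pos have "x div B + y div B < x + y" "0 < x + y" by auto
  then show "((B, x div B, y div B), (B, x, y)) \<in> Wellfounded.measure (\<lambda>(B, x, y). nat (x + y))"
    by simp
qed simp

text \<open>As a rewrite rule the defining equation could unfold its own recursive call without
  end.\<close>

declare digit_square_sum.simps [simp del]

text \<open>The equation survives when \<open>p\<close>, \<open>q\<close>, \<open>x\<close>,
  \<open>y\<close> all vanish, where the recursion stops. Leading zeros are therefore harmless, and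
  coordinates with different numbers of digits can share one length.\<close>

lemma digit_square_sum_step:
  assumes "B \<ge> 2" "0 \<le> p" "p < B" "0 \<le> q" "q < B" "0 \<le> x" "0 \<le> y"
  shows "digit_square_sum B (p + B * x) (q + B * y) =
           (p\<^sup>2 - q\<^sup>2 + fst (digit_square_sum B x y), 2 * p * q + snd (digit_square_sum B x y))"
proof (cases "p + B * x = 0 \<and> q + B * y = 0")
  case True
  then have "p = 0" "q = 0" "x = 0" "y = 0"
    using assms by (auto simp: add_nonneg_eq_0_iff)
  then show ?thesis by (simp add: digit_square_sum.simps)
next
  case False
  have "0 \<le> p + B * x" "0 \<le> q + B * y"
    using assms by auto
  moreover have "(p + B * x) mod B = p" "(q + B * y) mod B = q" "(p + B * x) div B = x" "(q + B * y) div B = y"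
    using assms by auto
  ultimately show ?thesis
    using assms(1) False
    by (subst digit_square_sum.simps) (auto simp: Let_def power2_eq_square)
qed

lemma digit_square_sum_eq:
  assumes "B \<ge> 2" "\<And>j. j \<le> n \<Longrightarrow> 0 \<le> c j \<and> c j < B" "\<And>j. j \<le> n \<Longrightarrow> 0 \<le> d j \<and> d j < B"
  shows "digit_square_sum B (\<Sum>j\<le>n. c j * B ^ j) (\<Sum>j\<le>n. d j * B ^ j) =
           (\<Sum>j\<le>n. (c j)\<^sup>2 - (d j)\<^sup>2, \<Sum>j\<le>n. 2 * c j * d j)"
  using assms(2,3)
proof (induction n arbitrary: c d)
  case 0
  then show ?case
    using digit_square_sum_step[OF assms(1), of "c 0" "d 0" 0 0]
    by (simp add: digit_square_sum.simps)
next
  case (Suc n)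
  have shift: "(\<Sum>j\<le>Suc n. e j * B ^ j) = e 0 + B * (\<Sum>j\<le>n. e (Suc j) * B ^ j)" for e :: "nat \<Rightarrow> int"
    by (subst sum.atMost_Suc_shift) (simp add: sum_distrib_left mult_ac)
  have "0 \<le> (\<Sum>j\<le>n. c (Suc j) * B ^ j)" "0 \<le> (\<Sum>j\<le>n. d (Suc j) * B ^ j)"
    using assms(1) Suc.prems by (auto intro!: sum_nonneg)
  then have "digit_square_sum B (\<Sum>j\<le>Suc n. c j * B ^ j) (\<Sum>j\<le>Suc n. d j * B ^ j) =
      ((c 0)\<^sup>2 - (d 0)\<^sup>2 + (\<Sum>j\<le>n. (c (Suc j))\<^sup>2 - (d (Suc j))\<^sup>2),
       2 * c 0 * d 0 + (\<Sum>j\<le>n. 2 * c (Suc j) * d (Suc j)))"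
    unfolding shift using Suc.prems Suc.IH[of "\<lambda>j. c (Suc j)" "\<lambda>j. d (Suc j)"]
    by (subst digit_square_sum_step[OF assms(1)]) auto
  then show ?case
    by (simp only: sum.atMost_Suc_shift)
qed

section \<open>The happy function on integer pairs\<close>

text \<open>All digits of a coordinate carry its sign: their squares ignore it, while the cross
  terms pick up the product of the two signs.\<close>

definition pair_happy_fun :: "int \<Rightarrow> int \<times> int \<Rightarrow> int \<times> int" where
  "pair_happy_fun B p =
     (let r = digit_square_sum B \<bar>fst p\<bar> \<bar>snd p\<bar> in (fst r, sgn (fst p) * sgn (snd p) * snd r))"

definition complex_of_pair :: "int \<times> int \<Rightarrow> complex" where
  "complex_of_pair p = of_int (fst p) + of_int (snd p) * \<i>"

lemma complex_of_pair_sel [simp]: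
  "Re (complex_of_pair p) = of_int (fst p)" "Im (complex_of_pair p) = of_int (snd p)"
  by (simp_all add: complex_of_pair_def)

lemma complex_of_pair_eq_iff [simp]: "complex_of_pair p = complex_of_pair q \<longleftrightarrow> p = q"
  by (auto simp: complex_eq_iff prod_eq_iff)

lemma complex_of_pair_eq_1_iff [simp]: "complex_of_pair p = 1 \<longleftrightarrow> p = (1, 0)"
  by (auto simp: complex_eq_iff prod_eq_iff)

lemma complex_of_pair_symmetries:
  "- complex_of_pair (x, y) = complex_of_pair (- x, - y)"
  "cnj (complex_of_pair (x, y)) = complex_of_pair (x, - y)"
  "\<i> * complex_of_pair (x, y) = complex_of_pair (- y, x)"
  by (simp_all add: complex_eq_iff)

lemma gaussian_ints_eq_range: "gaussian_ints = range complex_of_pair"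
proof (intro equalityI subsetI)
  fix z assume "z \<in> gaussian_ints"
  then obtain x y :: int where "Re z = of_int x" "Im z = of_int y"
    by (auto simp: gaussian_ints_def elim!: Ints_cases)
  then have "z = complex_of_pair (x, y)" by (simp add: complex_eq_iff)
  then show "z \<in> range complex_of_pair" by blast
qed (auto simp: gaussian_ints_def)

lemma signed_digits_abs:
  fixes a :: "nat \<Rightarrow> int"
  assumes "x = (\<Sum>j\<le>n. a j * B ^ j)" "\<And>j. j \<le> n \<Longrightarrow> \<bar>a j\<bar> \<le> B - 1 \<and> sgn x * a j \<ge> 0" "B \<ge> 2"
  obtains c where "\<bar>x\<bar> = (\<Sum>j\<le>n. c j * B ^ j)" "\<And>j. j \<le> n \<Longrightarrow> 0 \<le> c j \<and> c j < B"
    "\<And>j. j \<le> n \<Longrightarrow> (a j)\<^sup>2 = (c j)\<^sup>2 \<and> a j = sgn x * c j"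
proof
  \<comment> \<open>For \<open>x = 0\<close> the sign condition is vacuous and the witness
    \<open>sgn x * a j\<close> is zero, so the digits themselves have to vanish; their bound forces
    this.\<close>
  have a0: "a j = 0" if "x = 0" "j \<le> n" for j
    using digits_of_zero[of a B n j] assms that by simp
  show "\<bar>x\<bar> = (\<Sum>j\<le>n. sgn x * a j * B ^ j)"
    by (subst abs_sgn, subst (1) assms(1)) (simp only: sum_distrib_left sum_distrib_right mult_ac)
  show "0 \<le> sgn x * a j \<and> sgn x * a j < B" if "j \<le> n" for j
    using assms(2)[OF that] assms(3) by (auto simp: sgn_if)
  show "(a j)\<^sup>2 = (sgn x * a j)\<^sup>2 \<and> a j = sgn x * (sgn x * a j)" if "j \<le> n" for j
    using a0[OF _ that] by (auto simp: sgn_if)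
qed

text \<open>This makes the definite description computable: the recursion gives the digit square sum
  of one expansion, and uniqueness of that sum does the rest.\<close>

lemma gaussian_happy_fun_complex_of_pair:
  assumes B: "B \<ge> 2"
  shows "gaussian_happy_fun B (complex_of_pair p) = complex_of_pair (pair_happy_fun (int B) p)"
proof (cases "complex_of_pair p = 0")
  case True
  then have "p = (0, 0)" by (simp add: complex_eq_iff prod_eq_iff)
  then show ?thesis
    by (simp add: gaussian_happy_fun_def pair_happy_fun_def complex_of_pair_def digit_square_sum.simps)
next
  case False
  define x y where xy: "x = fst p" "y = snd p"
  have z: "complex_of_pair p \<in> gaussian_ints" by (simp add: gaussian_ints_eq_range)
  obtain n a b where e: "gaussian_expansion B (complex_of_pair p) n a b"
    using gaussian_expansion_exists[OF B z False] by blast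
  have B': "int B \<ge> 2" using B by simp
  have parts: "x = (\<Sum>j\<le>n. a j * int B ^ j)" "y = (\<Sum>j\<le>n. b j * int B ^ j)"
    using gaussian_expansion_parts[OF e] unfolding complex_of_pair_sel of_int_eq_iff xy by blast+
  have digits: "\<bar>a j\<bar> \<le> int B - 1 \<and> sgn x * a j \<ge> 0" "\<bar>b j\<bar> \<le> int B - 1 \<and> sgn y * b j \<ge> 0" if "j \<le> n" for j
    using e that unfolding gaussian_expansion_def complex_of_pair_sel sgn_of_int_mult_nonneg xy
    by blast+
  obtain c where c: "\<bar>x\<bar> = (\<Sum>j\<le>n. c j * int B ^ j)" "\<And>j. j \<le> n \<Longrightarrow> 0 \<le> c j \<and> c j < int B"
      "\<And>j. j \<le> n \<Longrightarrow> (a j)\<^sup>2 = (c j)\<^sup>2 \<and> a j = sgn x * c j"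
    using signed_digits_abs[OF parts(1) digits(1) B'] by blast
  obtain d where d: "\<bar>y\<bar> = (\<Sum>j\<le>n. d j * int B ^ j)" "\<And>j. j \<le> n \<Longrightarrow> 0 \<le> d j \<and> d j < int B"
      "\<And>j. j \<le> n \<Longrightarrow> (b j)\<^sup>2 = (d j)\<^sup>2 \<and> b j = sgn y * d j"
    using signed_digits_abs[OF parts(2) digits(2) B'] by blast
  have r: "pair_happy_fun (int B) p =
          (\<Sum>j\<le>n. (c j)\<^sup>2 - (d j)\<^sup>2, sgn x * sgn y * (\<Sum>j\<le>n. 2 * c j * d j))"
    using digit_square_sum_eq[OF B' c(2) d(2)] c(1) d(1) by (simp add: pair_happy_fun_def xy)
  have "(\<Sum>j\<le>n. (c j)\<^sup>2 - (d j)\<^sup>2) = (\<Sum>j\<le>n. (a j)\<^sup>2 - (b j)\<^sup>2)"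
    using c(3) d(3) by (intro sum.cong[OF refl]) (metis atMost_iff)
  moreover have "sgn x * sgn y * (\<Sum>j\<le>n. 2 * c j * d j) = (\<Sum>j\<le>n. 2 * a j * b j)"
    unfolding sum_distrib_left
  proof (rule sum.cong[OF refl])
    fix j assume "j \<in> {..n}"
    then have "a j = sgn x * c j" "b j = sgn y * d j" using c(3) d(3) by blast+
    then show "sgn x * sgn y * (2 * c j * d j) = 2 * a j * b j" by (simp only: mult_ac)
  qed
  ultimately have "pair_happy_fun (int B) p = (\<Sum>j\<le>n. (a j)\<^sup>2 - (b j)\<^sup>2, \<Sum>j\<le>n. 2 * a j * b j)"
    unfolding r by simp
  then have "complex_of_pair (pair_happy_fun (int B) p) = (\<Sum>j\<le>n. (of_int (a j) + of_int (b j) * \<i>)\<^sup>2)"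
    by (simp add: complex_eq_iff power2_eq_square mult_ac)
  with e have "\<exists>n a b. gaussian_expansion B (complex_of_pair p) n a b \<and>
      complex_of_pair (pair_happy_fun (int B) p) = (\<Sum>j\<le>n. (of_int (a j) + of_int (b j) * \<i>)\<^sup>2)"
    by blast
  from the1_equality[OF gaussian_digit_square_sum_unique[OF B z False] this] False show ?thesis
    by (simp only: gaussian_happy_fun_def if_False)
qed

lemma pair_happy_fun_1:
  assumes "B \<ge> 2"
  shows "pair_happy_fun B (1, 0) = (1, 0)"
  using digit_square_sum_step[of B 1 0 0 0] assms
  by (simp add: pair_happy_fun_def digit_square_sum.simps)

section \<open>Symmetries\<close>

text \<open>Swapping turns each digit d = p + qi into i times its conjugate, whose square is minus
  the conjugate of d squared.\<close>

lemma digit_square_sum_swap: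
  "digit_square_sum B y x = (- fst (digit_square_sum B x y), snd (digit_square_sum B x y))"
proof (induction B x y rule: digit_square_sum.induct)
  case (1 B x y)
  then show ?case
    by (subst (1 2 3) digit_square_sum.simps) (auto simp: Let_def)
qed

lemma pair_happy_fun_symmetries:
  shows pair_happy_fun_minus_fst:
      "pair_happy_fun B (- x, y) = (fst (pair_happy_fun B (x, y)), - snd (pair_happy_fun B (x, y)))"
    and pair_happy_fun_minus_snd:
      "pair_happy_fun B (x, - y) = (fst (pair_happy_fun B (x, y)), - snd (pair_happy_fun B (x, y)))"
    and pair_happy_fun_swap:
      "pair_happy_fun B (y, x) = (- fst (pair_happy_fun B (x, y)), snd (pair_happy_fun B (x, y)))"
  using digit_square_sum_swap[of B "\<bar>y\<bar>" "\<bar>x\<bar>"]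
  by (simp_all add: pair_happy_fun_def Let_def sgn_minus mult_ac)

text \<open>Since \<open>(1, 0)\<close> is a fixed point, excluding it at the second iterate
  excludes it at all earlier ones.\<close>

definition pair_height_3 :: "int \<Rightarrow> int \<Rightarrow> int \<Rightarrow> bool" where
  "pair_height_3 B x y \<longleftrightarrow>
     (let p = pair_happy_fun B (pair_happy_fun B (x, y))
      in p \<noteq> (1, 0) \<and> pair_happy_fun B p = (1, 0))"

text \<open>Each symmetry flips the sign of one coordinate of the first iterate, hence only the
  imaginary sign of the second and third, and being \<open>(1, 0)\<close> does not depend on that
  sign.\<close>

lemma pair_height_3_symmetries:
  "pair_height_3 B (- x) y = pair_height_3 B x y"
  "pair_height_3 B x (- y) = pair_height_3 B x y"
  "pair_height_3 B y x = pair_height_3 B x y"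
proof -
  obtain u v where uv: "pair_happy_fun B (x, y) = (u, v)" by fastforce
  obtain s t where st: "pair_happy_fun B (u, v) = (s, t)" by fastforce
  \<comment> \<open>The swap is instantiated so that it rewrites only \<open>(y, x)\<close> to
    \<open>(x, y)\<close>; in general form it would apply to its own right-hand side.\<close>
  note sym = pair_happy_fun_minus_fst pair_happy_fun_minus_snd pair_happy_fun_swap[of B y x]
  show "pair_height_3 B (- x) y = pair_height_3 B x y"
    "pair_height_3 B x (- y) = pair_height_3 B x y"
    "pair_height_3 B y x = pair_height_3 B x y"
    by (auto simp: pair_height_3_def Let_def sym uv st prod_eq_iff)
qed

lemma pair_height_3_abs: "pair_height_3 B \<bar>x\<bar> \<bar>y\<bar> = pair_height_3 B x y"
  by (simp add: abs_if pair_height_3_symmetries(1,2))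

section \<open>Height three and minimal absolute value\<close>

lemma gaussian_happy_height_3_iff:
  assumes B: "B \<ge> 2"
  shows "gaussian_happy B w \<and> gaussian_happy_height B w = 3 \<longleftrightarrow>
           (\<exists>x y. w = complex_of_pair (x, y) \<and> pair_height_3 (int B) x y)"
proof (cases "w \<in> gaussian_ints")
  case True
  then obtain x y where w: "w = complex_of_pair (x, y)"
    by (auto simp: gaussian_ints_eq_range)
  let ?f = "gaussian_happy_fun B"
  have f1: "(?f ^^ m) 1 = 1" for m
  proof (induction m)
    case (Suc m)
    have "complex_of_pair (1, 0) = 1" by simp
    then have "?f 1 = 1"
      using gaussian_happy_fun_complex_of_pair[OF B, of "(1, 0)"] pair_happy_fun_1[of "int B"] B
      by (simp del: complex_of_pair_eq_1_iff)
    with Suc show ?case by simp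
  qed simp
  have "gaussian_happy B w \<and> gaussian_happy_height B w = 3 \<longleftrightarrow> (?f ^^ 2) w \<noteq> 1 \<and> (?f ^^ 3) w = 1"
  proof
    assume l: "gaussian_happy B w \<and> gaussian_happy_height B w = 3"
    \<comment> \<open>Happiness supplies a witness, so the \<open>LEAST\<close> in the height is
      attained.\<close>
    then obtain k where "(?f ^^ k) w = 1" by (auto simp: gaussian_happy_def)
    then have "(?f ^^ 3) w = 1"
      using l LeastI[of "\<lambda>k. (?f ^^ k) w = 1" k] by (simp only: gaussian_happy_height_def)
    moreover have "(?f ^^ 2) w \<noteq> 1"
      using l not_less_Least[of 2 "\<lambda>k. (?f ^^ k) w = 1"] by (simp add: gaussian_happy_height_def)
    ultimately show "(?f ^^ 2) w \<noteq> 1 \<and> (?f ^^ 3) w = 1" by blast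
  next
    assume r: "(?f ^^ 2) w \<noteq> 1 \<and> (?f ^^ 3) w = 1"
    have "3 \<le> k" if "(?f ^^ k) w = 1" for k
    proof (rule ccontr)
      assume "\<not> 3 \<le> k"
      \<comment> \<open>An orbit that has reached 1 by step \<open>k\<close> is still there at step
        2.\<close>
      then have "(?f ^^ 2) w = (?f ^^ (2 - k)) ((?f ^^ k) w)"
        by (simp flip: funpow_add comp_apply[of "_ ^^ _" "_ ^^ _"])
      with that r f1 show False by simp
    qed
    with r have "gaussian_happy_height B w = 3"
      unfolding gaussian_happy_height_def by (intro Least_equality) auto
    moreover have "gaussian_happy B w"
      using r True by (auto simp: gaussian_happy_def intro: exI[of _ 3])
    ultimately show "gaussian_happy B w \<and> gaussian_happy_height B w = 3" by simp
  qed
  also have "\<dots> \<longleftrightarrow> pair_height_3 (int B) x y"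
    using gaussian_happy_fun_complex_of_pair[OF B]
    by (simp add: w pair_height_3_def Let_def eval_nat_numeral)
  finally show ?thesis by (auto simp: w)
qed (auto simp: gaussian_happy_def gaussian_ints_eq_range)

text \<open>The wedge \<open>y \<le> x\<close> contains one representative per symmetry class; for
  \<open>z\<close> with \<open>a \<le> b\<close> it is \<open>(b, a)\<close>, which explains the
  exchanged roles in \<open>unique\<close>.\<close>

lemma is_arg_min_height_3:
  assumes B: "B \<ge> 2" and ab: "0 \<le> a" "a \<le> b"
    and unique: "\<And>x y. 0 \<le> y \<Longrightarrow> y \<le> x \<Longrightarrow> x * x + y * y \<le> a * a + b * b \<Longrightarrow>
                   pair_height_3 (int B) x y \<longleftrightarrow> x = b \<and> y = a"
  defines "z \<equiv> complex_of_pair (a, b)"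
  shows "{w. is_arg_min cmod (\<lambda>u. gaussian_happy B u \<and> gaussian_happy_height B u = 3) w}
           = {z, - z, cnj z, - cnj z, \<i> * z, - (\<i> * z), \<i> * cnj z, - (\<i> * cnj z)}"
proof -
  define orbit where
    "orbit = {z, - z, cnj z, - cnj z, \<i> * z, - (\<i> * z), \<i> * cnj z, - (\<i> * cnj z)}"
  define Q where "Q w \<longleftrightarrow> gaussian_happy B w \<and> gaussian_happy_height B w = 3" for w
  have Q_pair: "Q (complex_of_pair (x, y)) \<longleftrightarrow> pair_height_3 (int B) x y" for x y
    unfolding Q_def gaussian_happy_height_3_iff[OF B] by auto
  have small: "pair_height_3 (int B) x y \<longleftrightarrow> \<bar>x\<bar> = a \<and> \<bar>y\<bar> = b \<or> \<bar>x\<bar> = b \<and> \<bar>y\<bar> = a"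
    if "x * x + y * y \<le> a * a + b * b" for x y
  proof (cases "\<bar>y\<bar> \<le> \<bar>x\<bar>")
    case True
    then show ?thesis
      using unique[of "\<bar>y\<bar>" "\<bar>x\<bar>"] that ab by (auto simp: pair_height_3_abs)
  next
    case False
    then show ?thesis
      using unique[of "\<bar>x\<bar>" "\<bar>y\<bar>"] that ab
      by (auto simp: pair_height_3_abs pair_height_3_symmetries(3)[of _ y x])
  qed
  have norm: "cmod (complex_of_pair (x, y)) = sqrt (of_int (x * x + y * y))" for x y
    by (simp add: cmod_def power2_eq_square)
  \<comment> \<open>The eight listed numbers are all choices of signs and order for the coordinates
    \<open>a\<close> and \<open>b\<close>.\<close>
  have orbit_pair: "complex_of_pair (x, y) \<in> orbit \<longleftrightarrow> \<bar>x\<bar> = a \<and> \<bar>y\<bar> = b \<or> \<bar>x\<bar> = b \<and> \<bar>y\<bar> = a" for x y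
    unfolding orbit_def z_def complex_of_pair_symmetries insert_iff complex_of_pair_eq_iff empty_iff
      prod.inject
    using ab by (simp only: abs_if) (smt (verit))
  have orbit_norm: "cmod w = cmod z" if "w \<in> orbit" for w
    using that unfolding orbit_def by (elim insertE emptyE) (simp_all add: norm_mult)
  have orbit_Q: "Q w" if "w \<in> orbit" for w
  proof -
    have "w \<in> gaussian_ints"
      using that unfolding orbit_def z_def complex_of_pair_symmetries gaussian_ints_eq_range by blast
    then obtain x y where w: "w = complex_of_pair (x, y)" by (auto simp: gaussian_ints_eq_range)
    have *: "\<bar>x\<bar> = a \<and> \<bar>y\<bar> = b \<or> \<bar>x\<bar> = b \<and> \<bar>y\<bar> = a"
      using that unfolding w orbit_pair .
    \<comment> \<open>Orbit points lie on the boundary of the disc, which \<open>small\<close>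
      includes.\<close>
    then have "x * x + y * y = a * a + b * b" by auto
    with * small[of x y] show ?thesis unfolding w Q_pair by simp
  qed
  have Q_orbit: "w \<in> orbit" if "Q w" "cmod w \<le> cmod z" for w
  proof -
    from that(1) obtain x y where w: "w = complex_of_pair (x, y)" "pair_height_3 (int B) x y"
      unfolding Q_def gaussian_happy_height_3_iff[OF B] by blast
    with that(2) have "x * x + y * y \<le> a * a + b * b"
      unfolding z_def norm w(1) by (simp only: real_sqrt_le_iff of_int_le_iff)
    from small[OF this] w(2) show ?thesis unfolding w(1) orbit_pair by blast
  qed
  have "is_arg_min cmod Q w \<longleftrightarrow> w \<in> orbit" for w
  proof
    assume min: "is_arg_min cmod Q w"
    have "Q z" by (rule orbit_Q) (simp add: orbit_def)
    with min have "cmod w \<le> cmod z" by (auto simp: is_arg_min_def not_less)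
    with min Q_orbit show "w \<in> orbit" unfolding is_arg_min_def by blast
  next
    assume w: "w \<in> orbit"
    have "cmod w \<le> cmod u" if "Q u" for u
      \<comment> \<open>A \<open>u\<close> no larger than \<open>z\<close> would lie in the orbit
        and so have the norm of \<open>z\<close>; any other \<open>u\<close> is larger.\<close>
      using Q_orbit[OF that] orbit_norm[of u] orbit_norm[OF w] by linarith
    with orbit_Q[OF w] show "is_arg_min cmod Q w" by (auto simp: is_arg_min_def not_less)
  qed
  then show ?thesis
    unfolding orbit_def Q_def by blast
qed

section \<open>The finite check\<close>

text \<open>The conditional, in place of an implication, is meant to spare the costly height test
  outside the disc.\<close>

definition height_3_check_point :: "int \<Rightarrow> int \<Rightarrow> int \<Rightarrow> int \<Rightarrow> int \<Rightarrow> bool" where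
  "height_3_check_point B a b x y \<longleftrightarrow>
     (if x * x + y * y \<le> a * a + b * b then pair_height_3 B x y \<longleftrightarrow> x = b \<and> y = a else True)"

(* Recursion through named predicates instead of list_all: code_simp would also rewrite underneath
   the lambda at every step of list_all, which makes the evaluation ten times slower. *)
primrec height_3_check_row :: "int \<Rightarrow> int \<Rightarrow> int \<Rightarrow> int \<Rightarrow> int list \<Rightarrow> bool" where
  "height_3_check_row B a b x [] \<longleftrightarrow> True"
| "height_3_check_row B a b x (y # ys) \<longleftrightarrow> height_3_check_point B a b x y \<and> height_3_check_row B a b x ys"

primrec height_3_check_rows :: "int \<Rightarrow> int \<Rightarrow> int \<Rightarrow> int list \<Rightarrow> bool" where
  "height_3_check_rows B a b [] \<longleftrightarrow> True"
| "height_3_check_rows B a b (x # xs) \<longleftrightarrow> height_3_check_row B a b x [0..x] \<and> height_3_check_rows B a b xs"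

text \<open>Here \<open>r\<close> bounds the columns to inspect:
  \<open>a * a + b * b < r * r\<close> confines the disc to \<open>x < r\<close>, with no square
  root to compute.\<close>

definition height_3_check :: "int \<Rightarrow> int \<Rightarrow> int \<Rightarrow> int \<Rightarrow> bool" where
  "height_3_check B r a b \<longleftrightarrow>
     0 \<le> r \<and> a * a + b * b < r * r \<and> height_3_check_rows B a b [0..r]"

lemma height_3_check_rows_iff:
  "height_3_check_rows B a b xs \<longleftrightarrow> (\<forall>x \<in> set xs. \<forall>y \<in> {0..x}. height_3_check_point B a b x y)"
proof -
  have "height_3_check_row B a b x ys \<longleftrightarrow> (\<forall>y \<in> set ys. height_3_check_point B a b x y)" for x ys
    by (induction ys) auto
  then show ?thesis by (induction xs) auto
qed

lemma height_3_checkD: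
  assumes "height_3_check B r a b" "0 \<le> y" "y \<le> x" "x * x + y * y \<le> a * a + b * b"
  shows "pair_height_3 B x y \<longleftrightarrow> x = b \<and> y = a"
proof -
  have "x * x < r * r" "0 \<le> r"
    using assms zero_le_square[of y] unfolding height_3_check_def by linarith+
  then have "x \<le> r"
    \<comment> \<open>By contraposition: \<open>r \<le> x\<close> would give
      \<open>r * r \<le> x * x\<close>.\<close>
    using mult_mono[of r x r x] by linarith
  with assms show ?thesis
    by (auto simp: height_3_check_def height_3_check_rows_iff height_3_check_point_def)
qed

text \<open>In each entry the second argument is the least integer exceeding the absolute value of
  z.\<close>

lemma height_3_checks:
  "height_3_check 2 2 1 1" "height_3_check 3 13 7 10" "height_3_check 4 2 1 1"
  "height_3_check 5 16 4 15" "height_3_check 6 21 11 17" "height_3_check 7 34 20 27"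
  "height_3_check 8 3 2 2" "height_3_check 9 10 2 9" "height_3_check 10 17 12 12"
  by code_simp+

theorem theorem9:
  fixes B :: nat and z :: complex
  assumes "(B, z) \<in> {(2, 1 + \<i>), (3, 7 + 10 * \<i>), (4, 1 + \<i>), (5, 4 + 15 * \<i>),
                      (6, 11 + 17 * \<i>), (7, 20 + 27 * \<i>), (8, 2 + 2 * \<i>),
                      (9, 2 + 9 * \<i>), (10, 12 + 12 * \<i>)}"
  shows "{w. is_arg_min cmod (\<lambda>u. gaussian_happy B u \<and> gaussian_happy_height B u = 3) w}
           = {z, - z, cnj z, - cnj z, \<i> * z, - (\<i> * z), \<i> * cnj z, - (\<i> * cnj z)}"
proof -
  have *: ?thesis
    if "height_3_check (int B) r a b" "B \<ge> 2" "0 \<le> a" "a \<le> b" "z = complex_of_pair (a, b)" for r a b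
    unfolding that(5) using that(2-4)
    by (rule is_arg_min_height_3) (rule height_3_checkD[OF that(1)])
  show ?thesis
    by (insert assms)
      (elim insertE emptyE Pair_inject;
        \<comment> \<open>Matching the numeral base against the table fixes the still open
          \<open>r\<close>, \<open>a\<close> and \<open>b\<close>.\<close>
        (rule *, simp only: of_nat_numeral, rule height_3_checks, simp_all add: complex_of_pair_def))
qed

end
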